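(* Let $(A,N)$ be a Nijenhuis algebra and $(M,N_M)$ a left $(A,N)$-module. Then $(M,N_M)$ can be embedded into an injective left $(A,N)$-module; that is, there exist an injective left $(A,N)$-module $(I,N_I)$ and an injective left $(A,N)$-module homomorphism $(M,N_M)\to(I,N_I)$.
   Context: Throughout, $\mathbf{k}$ is a commutative ring with unit; all modules, algebras and linear maps are over $\mathbf{k}$; algebras are associative with unit and modules are unital. A Nijenhuis algebra $(A,N)$ is an algebra $A$ with a linear map $N:A\to A$ such that $N(a)N(b)=N\big(N(a)b+aN(b)-N(ab)\big)$ for all $a,b\in A$. A left $(A,N)$-module $(M,N_M)$ is a left $A$-module $M$ with a linear map $N_M:M\to M$ such that $N(a)N_M(m)=N_M\big(N(a)m+aN_M(m)-N_M(am)\big)$ for all $a\in A$, $m\in M$. A left $(A,N)$-module homomorphism $(M,N_M)\to(M',N_{M'})$ is a left $A$-module homomorphism $f:M\to M'$ with $f\circ N_M=N_{M'}\circ f$. A left $(A,N)$-module $(I,N_I)$ is an injective left $(A,N)$-module if for every left $(A,N)$-module monomorphism (injective homomorphism) $f:(M,N_M)\to(M',N_{M'})$ and every left $(A,N)$-module homomorphism $g:(M,N_M)\to(I,N_I)$ there exists a left $(A,N)$-module homomorphism $\overline g:(M',N_{M'})\to(I,N_I)$ with $\overline g\circ f=g$. *)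

theory Defs
  imports Complex_Main "HOL-Algebra.Module"
begin

text \<open>
  Everything is carrier-based. \<open>HOL-Algebra\<close>'s \<open>algebra\<close> requires a commutative multiplication,
  so associative unital algebras over a commutative ring get their own locale. As usual for
  \<open>HOL-Algebra\<close> modules, the inherited fields \<open>mult\<close> and \<open>one\<close> of a module record carry no meaning.
\<close>

locale assoc_algebra = module + ring M +
  assumes smult_mult_left:
      "\<lbrakk>c \<in> carrier R; x \<in> carrier M; y \<in> carrier M\<rbrakk> \<Longrightarrow>
        (c \<odot>\<^bsub>M\<^esub> x) \<otimes>\<^bsub>M\<^esub> y = c \<odot>\<^bsub>M\<^esub> (x \<otimes>\<^bsub>M\<^esub> y)"
    and smult_mult_right:
      "\<lbrakk>c \<in> carrier R; x \<in> carrier M; y \<in> carrier M\<rbrakk> \<Longrightarrow>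
        x \<otimes>\<^bsub>M\<^esub> (c \<odot>\<^bsub>M\<^esub> y) = c \<odot>\<^bsub>M\<^esub> (x \<otimes>\<^bsub>M\<^esub> y)"

definition linear_maps ::
    "('r, 'x) ring_scheme \<Rightarrow> ('r, 'm, 'y) module_scheme \<Rightarrow> ('r, 'n, 'z) module_scheme \<Rightarrow> ('m \<Rightarrow> 'n) set"
  where "linear_maps k M M' =
    {f. f \<in> carrier M \<rightarrow> carrier M' \<and>
        (\<forall>x\<in>carrier M. \<forall>y\<in>carrier M. f (x \<oplus>\<^bsub>M\<^esub> y) = f x \<oplus>\<^bsub>M'\<^esub> f y) \<and>
        (\<forall>c\<in>carrier k. \<forall>x\<in>carrier M. f (c \<odot>\<^bsub>M\<^esub> x) = c \<odot>\<^bsub>M'\<^esub> f x)}"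

definition nijenhuis_algebra :: "'r ring \<Rightarrow> ('r, 'a) module \<Rightarrow> ('a \<Rightarrow> 'a) \<Rightarrow> bool"
  where "nijenhuis_algebra k A N \<longleftrightarrow>
    assoc_algebra k A \<and> N \<in> linear_maps k A A \<and>
    (\<forall>a\<in>carrier A. \<forall>b\<in>carrier A.
       N a \<otimes>\<^bsub>A\<^esub> N b = N (N a \<otimes>\<^bsub>A\<^esub> b \<oplus>\<^bsub>A\<^esub> a \<otimes>\<^bsub>A\<^esub> N b \<ominus>\<^bsub>A\<^esub> N (a \<otimes>\<^bsub>A\<^esub> b)))"

text \<open>
  A pair \<open>(M, N\<^sub>M)\<close> is one record: a module over the ground ring together with the action
  of the algebra and the operator \<open>N\<^sub>M\<close>.
\<close>

record ('r, 'a, 'm) nij_module = "('r, 'm) module" +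
  act :: "'a \<Rightarrow> 'm \<Rightarrow> 'm"
  nij :: "'m \<Rightarrow> 'm"

definition left_module :: "'r ring \<Rightarrow> ('r, 'a) module \<Rightarrow> ('r, 'a, 'm) nij_module \<Rightarrow> bool"
  where "left_module k A M \<longleftrightarrow>
    module k M \<and>
    (\<forall>a\<in>carrier A. act M a \<in> linear_maps k M M) \<and>
    (\<forall>a\<in>carrier A. \<forall>b\<in>carrier A. \<forall>m\<in>carrier M.
       act M (a \<oplus>\<^bsub>A\<^esub> b) m = act M a m \<oplus>\<^bsub>M\<^esub> act M b m) \<and>
    (\<forall>c\<in>carrier k. \<forall>a\<in>carrier A. \<forall>m\<in>carrier M.
       act M (c \<odot>\<^bsub>A\<^esub> a) m = c \<odot>\<^bsub>M\<^esub> act M a m) \<and>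
    (\<forall>a\<in>carrier A. \<forall>b\<in>carrier A. \<forall>m\<in>carrier M.
       act M (a \<otimes>\<^bsub>A\<^esub> b) m = act M a (act M b m)) \<and>
    (\<forall>m\<in>carrier M. act M \<one>\<^bsub>A\<^esub> m = m)"

definition nijenhuis_module ::
    "'r ring \<Rightarrow> ('r, 'a) module \<Rightarrow> ('a \<Rightarrow> 'a) \<Rightarrow> ('r, 'a, 'm) nij_module \<Rightarrow> bool"
  where "nijenhuis_module k A N M \<longleftrightarrow>
    left_module k A M \<and> nij M \<in> linear_maps k M M \<and>
    (\<forall>a\<in>carrier A. \<forall>m\<in>carrier M.
       act M (N a) (nij M m) =
       nij M (act M (N a) m \<oplus>\<^bsub>M\<^esub> act M a (nij M m) \<ominus>\<^bsub>M\<^esub> nij M (act M a m)))"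

definition nijenhuis_homs ::
    "'r ring \<Rightarrow> ('r, 'a) module \<Rightarrow> ('r, 'a, 'm) nij_module \<Rightarrow> ('r, 'a, 'n) nij_module \<Rightarrow> ('m \<Rightarrow> 'n) set"
  where "nijenhuis_homs k A M M' =
    {f \<in> linear_maps k M M'.
       (\<forall>a\<in>carrier A. \<forall>m\<in>carrier M. f (act M a m) = act M' a (f m)) \<and>
       (\<forall>m\<in>carrier M. f (nij M m) = nij M' (f m))}"

text \<open>
  The extension property of an injective module \<open>I\<close>, for all modules \<open>M\<close> with carrier in the
  type \<open>'s\<close> and all modules \<open>M'\<close> with carrier in the type \<open>'t\<close>.
\<close>

definition injective_against ::
    "'s itself \<Rightarrow> 't itself \<Rightarrow> 'r ring \<Rightarrow> ('r, 'a) module \<Rightarrow> ('a \<Rightarrow> 'a) \<Rightarrow>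
     ('r, 'a, 'i) nij_module \<Rightarrow> bool"
  where "injective_against S T k A N I \<longleftrightarrow>
    nijenhuis_module k A N I \<and>
    (\<forall>(M :: ('r, 'a, 's) nij_module) (M' :: ('r, 'a, 't) nij_module) f g.
       nijenhuis_module k A N M \<longrightarrow> nijenhuis_module k A N M' \<longrightarrow>
       f \<in> nijenhuis_homs k A M M' \<longrightarrow> inj_on f (carrier M) \<longrightarrow>
       g \<in> nijenhuis_homs k A M I \<longrightarrow>
       (\<exists>h \<in> nijenhuis_homs k A M' I. \<forall>m\<in>carrier M. h (f m) = g m))"

text \<open>
  A formula cannot quantify over types, so the carriers of test modules and of the module to be
  constructed have to be placed in sufficiently large types. Let \<open>X\<close> be a module with carrier in
  \<open>'m\<close>. Call words the finite words in the elements of the algebra and one extra letter (\<open>None\<close>)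
  for the operator; they act additively on \<open>X\<close>. Sending \<open>x\<close> to
  \<open>\<lambda>(\<chi>, w). \<chi> (w x)\<close>, with \<open>\<chi>\<close> an additive character of \<open>X\<close> with values in \<open>\<rat>/\<int>\<close>
  (represented in \<open>[0,1)\<close>), embeds \<open>X\<close> into a module with carrier in the following type.
\<close>

type_synonym ('a, 'm) char_space = "('m \<Rightarrow> rat) \<times> 'a option list \<Rightarrow> rat"

text \<open>
  Injectivity of a module \<open>I\<close> with carrier in \<open>'i\<close>. The chosen test types contain an embedding of
  \<open>I\<close> into the module of functions described above, which has the extension property against
  modules over arbitrary types. Splitting that embedding gives the same property for \<open>I\<close>, so
  \<open>injective_module k A N I\<close> entails \<open>injective_against TYPE('s) TYPE('t) k A N I\<close> for all types
  \<open>'s\<close>, \<open>'t\<close>, and no generality is lost.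
\<close>

definition injective_module ::
    "'r ring \<Rightarrow> ('r, 'a) module \<Rightarrow> ('a \<Rightarrow> 'a) \<Rightarrow> ('r, 'a, 'i) nij_module \<Rightarrow> bool"
  where "injective_module k A N (I :: ('r, 'a, 'i) nij_module) \<longleftrightarrow>
    injective_against TYPE('i) TYPE(('a, 'i) char_space) k A N I"

end

theory Submission
  imports Defs
begin

text \<open>
  Modules over \<open>(A, N)\<close> are the same as modules over one ring \<open>U\<close>, generated over \<open>\<int>\<close> by the
  elements of \<open>A\<close> and one further letter for the operator, subject to the relations that hold in
  every \<open>(A, N)\<close>-module. The theorem is therefore an instance of Baer's classical one:
  \<open>Hom(U, \<rat>/\<int>)\<close> is injective, and products of copies of it contain every module. The proof runs
  the classical argument without constructing \<open>U\<close>. An additive map \<open>U \<rightarrow> \<rat>/\<int>\<close> is recorded by its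
  values on words, that is, as a function on words that respects the defining relations
  (\<open>word_functionals\<close>); families of such functions, indexed by a type \<open>'j\<close>, form
  \<open>cofree_module\<close>, in which a letter acts by being appended to the argument.

  The reason for injectivity is an adjunction: a homomorphism from \<open>M\<close> into the cofree module is
  determined by the additive maps \<open>m \<mapsto> h m (j, [])\<close> from \<open>M\<close> to \<open>\<rat>/\<int>\<close>, and every family \<open>\<psi>\<close> of
  additive maps arises in this way, from \<open>h m (j, w) = \<psi> j (w m)\<close> (\<open>orbit_map_hom\<close>). Extending a
  homomorphism along a monomorphism thus reduces to extending additive maps into \<open>\<rat>/\<int>\<close>, which
  is possible because \<open>\<rat>/\<int>\<close> is divisible (\<open>characters_extend\<close>). Nothing here depends on the
  types of the two modules, so the cofree module has the extension property against modules over
  all types (\<open>cofree_injective_against\<close>). Letting \<open>j\<close> run through all additive maps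
  \<open>M \<rightarrow> \<rat>/\<int>\<close> embeds \<open>M\<close>, since these maps separate points (\<open>characters_separate\<close>).

  Conversely, let \<open>I\<close> have the extension property against its own embedding \<open>e\<close> into a cofree
  module. Extending the identity of \<open>I\<close> along \<open>e\<close> yields a retraction of \<open>e\<close>, so \<open>I\<close> inherits
  from the cofree module the extension property against all modules
  (\<open>injective_module_against\<close>).
\<close>

section \<open>Characters of abelian groups with values in \<open>\<rat>/\<int>\<close>\<close>

lemma int_subgroup_principal:
  fixes H :: "int set"
  assumes zero: "0 \<in> H" and diff: "\<And>m n. m \<in> H \<Longrightarrow> n \<in> H \<Longrightarrow> m - n \<in> H"
  obtains d where "\<And>n. n \<in> H \<longleftrightarrow> d dvd n"
proof -
  have neg: "- n \<in> H" if "n \<in> H" for n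
    using diff[OF zero that] by simp
  have add: "m + n \<in> H" if "m \<in> H" "n \<in> H" for m n
    using diff[OF that(1) neg[OF that(2)]] by simp
  have nat_multiple: "int t * n \<in> H" if "n \<in> H" for n t
    by (induction t) (auto simp: zero that add ring_distribs)
  have multiple: "t * n \<in> H" if "n \<in> H" for n t
    using nat_multiple[OF that, of "nat t"] neg[OF nat_multiple[OF that, of "nat (- t)"]]
    by (cases "t \<ge> 0") auto
  show thesis
  proof (cases "\<exists>n>0. n \<in> H")
    case False
    have "n \<in> H \<longleftrightarrow> 0 dvd n" for n
      using False neg[of n] zero by (cases n "0 :: int" rule: linorder_cases) auto
    then show thesis by (rule that)
  next
    case True
    \<comment> \<open>The least positive element generates, by division with remainder.\<close>
    define d where "d = (LEAST t. t > 0 \<and> int t \<in> H)"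
    from True obtain n where "n > 0" "n \<in> H" by blast
    then have "nat n > 0 \<and> int (nat n) \<in> H" by simp
    then have d: "d > 0" "int d \<in> H"
      unfolding d_def by (metis (mono_tags, lifting) LeastI)+
    have least: "d \<le> t" if "t > 0" "int t \<in> H" for t
      unfolding d_def using that by (simp add: Least_le)
    have "n \<in> H \<longleftrightarrow> int d dvd n" for n
    proof
      assume "n \<in> H"
      then have "n mod int d \<in> H"
        using diff[OF \<open>n \<in> H\<close> multiple[OF d(2), of "n div int d"]]
        by (simp add: minus_div_mult_eq_mod)
      moreover have "0 \<le> n mod int d" "n mod int d < int d"
        using d(1) by simp_all
      ultimately have "n mod int d = 0"
        using least[of "nat (n mod int d)"] by (cases "n mod int d = 0") auto
      then show "int d dvd n" by presburger
    qed (use multiple[OF d(2)] in \<open>auto simp: dvd_def mult.commute\<close>)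
    then show thesis by (rule that)
  qed
qed

text \<open>
  A character of a subgroup \<open>H\<close> of \<open>G\<close> is encoded by the subgroup of \<open>G \<times> \<rat>\<close> of all \<open>(x, q)\<close> such
  that \<open>x \<in> H\<close> and \<open>q\<close> represents the value at \<open>x\<close> modulo \<open>\<int>\<close>. Being single-valued modulo \<open>\<int>\<close>
  amounts to meeting \<open>{\<one>} \<times> \<rat>\<close> exactly in the integers. In this form characters of larger
  subgroups are supersets, so that Zorn's lemma applies to plain inclusion.
\<close>

definition character_graph :: "('g, 'x) monoid_scheme \<Rightarrow> ('g \<times> rat) set \<Rightarrow> bool"
  where "character_graph G S \<longleftrightarrow>
    S \<subseteq> carrier G \<times> UNIV \<and>
    (\<forall>x y q r. (x, q) \<in> S \<longrightarrow> (y, r) \<in> S \<longrightarrow> (x \<otimes>\<^bsub>G\<^esub> inv\<^bsub>G\<^esub> y, q - r) \<in> S) \<and>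
    (\<forall>q. (\<one>\<^bsub>G\<^esub>, q) \<in> S \<longleftrightarrow> q \<in> \<int>)"

lemma character_graphD:
  assumes "character_graph G S"
  shows "(x, q) \<in> S \<Longrightarrow> x \<in> carrier G"
    and "(x, q) \<in> S \<Longrightarrow> (y, r) \<in> S \<Longrightarrow> (x \<otimes>\<^bsub>G\<^esub> inv\<^bsub>G\<^esub> y, q - r) \<in> S"
    and "(\<one>\<^bsub>G\<^esub>, q) \<in> S \<longleftrightarrow> q \<in> \<int>"
  using assms unfolding character_graph_def by auto

lemma character_graph_mult:
  assumes "group G" and S: "character_graph G S" and x: "(x, q) \<in> S" and y: "(y, r) \<in> S"
  shows "(x \<otimes>\<^bsub>G\<^esub> y, q + r) \<in> S"
proof -
  interpret group G by fact
  have "(\<one>\<^bsub>G\<^esub>, 0) \<in> S" using character_graphD(3)[OF S] by simp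
  from character_graphD(2)[OF S this y] have "(inv\<^bsub>G\<^esub> y, - r) \<in> S"
    using character_graphD(1)[OF S y] by simp
  from character_graphD(2)[OF S x this] show ?thesis
    using character_graphD(1)[OF S y] by simp
qed

lemma character_graph_int_pow:
  assumes "group G" and S: "character_graph G S" and x: "(x, q) \<in> S"
  shows "(x [^]\<^bsub>G\<^esub> (n :: int), of_int n * q) \<in> S"
proof -
  interpret group G by fact
  note xG = character_graphD(1)[OF S x]
  have one: "(\<one>\<^bsub>G\<^esub>, 0) \<in> S" using character_graphD(3)[OF S] by simp
  have pow: "(x [^]\<^bsub>G\<^esub> (int t), of_nat t * q) \<in> S" for t
  proof (induction t)
    case (Suc t)
    then show ?case
      using character_graph_mult[OF assms(1) S Suc.IH x] xG
      unfolding int_pow_int by (simp add: ring_distribs add.commute)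
  qed (use one in simp)
  show ?thesis
  proof (cases n rule: int_cases2)
    case (nonneg t)
    then show ?thesis using pow by simp
  next
    case (nonpos t)
    then show ?thesis
      using character_graphD(2)[OF S one pow[of t]] xG by (simp add: int_pow_neg)
  qed
qed

text \<open>
  Divisibility of \<open>\<rat>\<close> enters here. The exponents \<open>n\<close> for which \<open>x\<^sup>n\<close> lies in the domain are the
  multiples of some \<open>d\<close>; any \<open>q\<close> such that \<open>d q\<close> is an admissible value at \<open>x\<^sup>d\<close> may be declared
  to be the value at \<open>x\<close>. For \<open>d = 0\<close> this allows every \<open>q\<close>. The value is left to the caller
  because separating points requires a suitable choice of it.
\<close>

lemma character_graph_adjoin:
  assumes "comm_group G" and S: "character_graph G S" and xG: "x \<in> carrier G"
    and dom: "\<And>n :: int. (\<exists>r. (x [^]\<^bsub>G\<^esub> n, r) \<in> S) \<Longrightarrow> d dvd n"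
    and q: "(x [^]\<^bsub>G\<^esub> d, of_int d * q) \<in> S"
  obtains S' where "character_graph G S'" "S \<subseteq> S'" "(x, q) \<in> S'"
proof -
  interpret comm_group G by fact
  define S' where "S' = {(s \<otimes>\<^bsub>G\<^esub> x [^]\<^bsub>G\<^esub> m, r + of_int m * q) | s r (m :: int). (s, r) \<in> S}"
  note SG = character_graphD(1)[OF S]
  have S'I: "(s \<otimes>\<^bsub>G\<^esub> x [^]\<^bsub>G\<^esub> m, r + of_int m * q) \<in> S'" if "(s, r) \<in> S" for s r and m :: int
    using that unfolding S'_def by blast
  have "S \<subseteq> S'"
    using S'I[of _ _ 0] SG by fastforce
  moreover have "(x, q) \<in> S'"
    using S'I[of "\<one>\<^bsub>G\<^esub>" 0 1] xG character_graphD(3)[OF S] by (simp add: int_pow_1)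
  moreover have "character_graph G S'"
    unfolding character_graph_def
  proof (intro conjI allI impI)
    show "S' \<subseteq> carrier G \<times> UNIV"
      using SG xG unfolding S'_def by auto
  next
    fix y z u v assume "(y, u) \<in> S'" "(z, v) \<in> S'"
    then obtain s r and m :: int and s' r' and m' :: int where
      y: "y = s \<otimes>\<^bsub>G\<^esub> x [^]\<^bsub>G\<^esub> m" "u = r + of_int m * q" "(s, r) \<in> S" and
      z: "z = s' \<otimes>\<^bsub>G\<^esub> x [^]\<^bsub>G\<^esub> m'" "v = r' + of_int m' * q" "(s', r') \<in> S"
      unfolding S'_def by blast
    have "y \<otimes>\<^bsub>G\<^esub> inv\<^bsub>G\<^esub> z = (s \<otimes>\<^bsub>G\<^esub> inv\<^bsub>G\<^esub> s') \<otimes>\<^bsub>G\<^esub> x [^]\<^bsub>G\<^esub> (m - m')"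
      using y(1) z(1) SG[OF y(3)] SG[OF z(3)] xG
      by (simp add: int_pow_diff inv_mult m_ac)
    moreover have "u - v = (r - r') + of_int (m - m') * q"
      using y(2) z(2) by (simp add: algebra_simps)
    ultimately show "(y \<otimes>\<^bsub>G\<^esub> inv\<^bsub>G\<^esub> z, u - v) \<in> S'"
      using S'I[OF character_graphD(2)[OF S y(3) z(3)], of "m - m'"] by simp
  next
    fix p
    show "(\<one>\<^bsub>G\<^esub>, p) \<in> S' \<longleftrightarrow> p \<in> \<int>"
    proof
      assume "(\<one>\<^bsub>G\<^esub>, p) \<in> S'"
      then obtain s r and m :: int where
        p: "\<one>\<^bsub>G\<^esub> = s \<otimes>\<^bsub>G\<^esub> x [^]\<^bsub>G\<^esub> m" "p = r + of_int m * q" "(s, r) \<in> S"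
        unfolding S'_def by blast
      have "x [^]\<^bsub>G\<^esub> m = inv\<^bsub>G\<^esub> s"
        using p(1) SG[OF p(3)] xG by (metis int_pow_closed inv_equality inv_inv m_comm)
      also have "(inv\<^bsub>G\<^esub> s, - r) \<in> S"
        using character_graph_int_pow[OF group_axioms S p(3), of "- 1"] SG[OF p(3)]
        by (simp add: int_pow_neg)
      \<comment> \<open>So \<open>x\<^sup>m\<close> has a value both from \<open>S\<close> and from \<open>q\<close>; they agree modulo \<open>\<int>\<close> as \<open>d\<close> divides \<open>m\<close>.\<close>
      finally have "d dvd m" using dom by blast
      then obtain t where t: "m = d * t" by (elim dvdE)
      have "(x [^]\<^bsub>G\<^esub> m, of_int m * q) \<in> S"
        using character_graph_int_pow[OF group_axioms S q, of t] xG
        by (simp add: int_pow_pow t mult_ac)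
      from character_graph_mult[OF group_axioms S p(3) this] p(1,2)
      show "p \<in> \<int>" using character_graphD(3)[OF S] by simp
    qed (use \<open>S \<subseteq> S'\<close> character_graphD(3)[OF S] in blast)
  qed
  ultimately show thesis using that by blast
qed

lemma character_graph_domain:
  assumes "group G" and S: "character_graph G S" and xG: "x \<in> carrier G"
  obtains d :: int where "\<And>n :: int. (\<exists>r. (x [^]\<^bsub>G\<^esub> n, r) \<in> S) \<longleftrightarrow> d dvd n"
proof -
  interpret group G by fact
  have "0 \<in> {n :: int. \<exists>r. (x [^]\<^bsub>G\<^esub> n, r) \<in> S}"
    using character_graphD(3)[OF S, of 0] by auto
  moreover have "m - n \<in> {n :: int. \<exists>r. (x [^]\<^bsub>G\<^esub> n, r) \<in> S}"
    if "m \<in> {n. \<exists>r. (x [^]\<^bsub>G\<^esub> n, r) \<in> S}" "n \<in> {n. \<exists>r. (x [^]\<^bsub>G\<^esub> n, r) \<in> S}" for m n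
    using that character_graphD(2)[OF S] xG by (force simp: int_pow_diff)
  ultimately show thesis
    using int_subgroup_principal[of "{n :: int. \<exists>r. (x [^]\<^bsub>G\<^esub> n, r) \<in> S}"] that by auto
qed

text \<open>
  The group \<open>\<rat>/\<int>\<close> is represented by \<open>[0,1)\<close> with addition followed by \<open>frac\<close>.
\<close>

definition characters :: "('g, 'x) monoid_scheme \<Rightarrow> ('g \<Rightarrow> rat) set"
  where "characters G =
    {\<chi>. \<chi> \<in> carrier G \<rightarrow> {0..<1} \<and>
        (\<forall>x\<in>carrier G. \<forall>y\<in>carrier G. \<chi> (x \<otimes>\<^bsub>G\<^esub> y) = frac (\<chi> x + \<chi> y))}"

lemma frac_diff_simps:
  "frac (frac x - y) = frac (x - y)" "frac (x - frac y) = frac (x - y)"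
  using frac_add_simps(1)[of x "- y"] by (simp_all add: frac_diff_simp)

lemma frac_add_diff: "frac (frac x + frac y - frac z) = frac (x + y - z)"
proof -
  have "frac (frac x + frac y - frac z) = frac (frac x + (frac y - frac z))"
    by (simp only: add_diff_eq)
  also have "\<dots> = frac (x + (frac y - frac z))"
    by (rule frac_add_simps)
  also have "\<dots> = frac (frac y + (x - frac z))"
    by (simp only: algebra_simps)
  also have "\<dots> = frac (y + (x - frac z))"
    by (rule frac_add_simps)
  also have "\<dots> = frac (x + y - frac z)"
    by (simp only: algebra_simps)
  also have "\<dots> = frac (x + y - z)"
    by (rule frac_diff_simps)
  finally show ?thesis .
qed

lemma character_range: "\<chi> \<in> characters G \<Longrightarrow> x \<in> carrier G \<Longrightarrow> \<chi> x \<in> {0..<1}"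
  and character_mult: "\<chi> \<in> characters G \<Longrightarrow> x \<in> carrier G \<Longrightarrow> y \<in> carrier G \<Longrightarrow>
    \<chi> (x \<otimes>\<^bsub>G\<^esub> y) = frac (\<chi> x + \<chi> y)"
  unfolding characters_def by auto

lemma character_frac: "\<chi> \<in> characters G \<Longrightarrow> x \<in> carrier G \<Longrightarrow> frac (\<chi> x) = \<chi> x"
  using character_range by (rule frac_eq_id)

lemma character_divide:
  assumes "group G" and \<chi>: "\<chi> \<in> characters G" and x: "x \<in> carrier G" and y: "y \<in> carrier G"
  shows "\<chi> (x \<otimes>\<^bsub>G\<^esub> inv\<^bsub>G\<^esub> y) = frac (\<chi> x - \<chi> y)"
proof -
  interpret group G by fact
  have "\<chi> x = frac (\<chi> (x \<otimes>\<^bsub>G\<^esub> inv\<^bsub>G\<^esub> y) + \<chi> y)"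
    using character_mult[OF \<chi>, of "x \<otimes>\<^bsub>G\<^esub> inv\<^bsub>G\<^esub> y" y] x y by (simp add: m_assoc)
  then have "frac (\<chi> x - \<chi> y) = frac (\<chi> (x \<otimes>\<^bsub>G\<^esub> inv\<^bsub>G\<^esub> y))"
    by (metis frac_diff_simps(1) add_diff_cancel_right')
  then show ?thesis
    using character_frac[OF \<chi>] x y by simp
qed

lemma character_one:
  assumes "group G" and \<chi>: "\<chi> \<in> characters G"
  shows "\<chi> \<one>\<^bsub>G\<^esub> = 0"
proof -
  interpret group G by fact
  show ?thesis
    using character_divide[OF assms, of "\<one>\<^bsub>G\<^esub>" "\<one>\<^bsub>G\<^esub>"] by simp
qed

text \<open>
  By Zorn's lemma there is a maximal graph above \<open>S\<close>. Its domain is all of \<open>G\<close>, for otherwise one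
  more element could be adjoined.
\<close>

lemma character_graph_extends:
  assumes "comm_group G" and S: "character_graph G S"
  obtains \<chi> where "\<chi> \<in> characters G" "\<And>x q. (x, q) \<in> S \<Longrightarrow> \<chi> x = frac q"
proof -
  interpret comm_group G by fact
  define Z where "Z = {T. character_graph G T \<and> S \<subseteq> T}"
  have "\<exists>T\<in>Z. \<forall>X\<in>Z. T \<subseteq> X \<longrightarrow> X = T"
  proof (rule subset_Zorn_nonempty)
    show "Z \<noteq> {}" using S unfolding Z_def by blast
  next
    fix C assume C: "C \<noteq> {}" "subset.chain Z C"
    then have CZ: "C \<subseteq> Z" by (simp add: subset.chain_def)
    have cg: "character_graph G T" if "T \<in> C" for T
      using that CZ unfolding Z_def by blast
    have "character_graph G (\<Union>C)"
      unfolding character_graph_def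
    proof (intro conjI allI impI)
      show "\<Union>C \<subseteq> carrier G \<times> UNIV"
        using character_graphD(1)[OF cg] by auto
    next
      fix x y q r assume "(x, q) \<in> \<Union>C" "(y, r) \<in> \<Union>C"
      then obtain T U where TU: "T \<in> C" "(x, q) \<in> T" "U \<in> C" "(y, r) \<in> U" by blast
      have "T \<subseteq> U \<or> U \<subseteq> T"
        using C(2) TU(1,3) by (auto simp: subset_chain_def)
      then show "(x \<otimes>\<^bsub>G\<^esub> inv\<^bsub>G\<^esub> y, q - r) \<in> \<Union>C"
        using character_graphD(2)[OF cg] TU by blast
    next
      fix q show "(\<one>\<^bsub>G\<^esub>, q) \<in> \<Union>C \<longleftrightarrow> q \<in> \<int>"
        using C(1) character_graphD(3)[OF cg] by auto
    qed
    then show "\<Union>C \<in> Z" using C(1) CZ unfolding Z_def by blast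
  qed
  then obtain T where T: "character_graph G T" "S \<subseteq> T"
    and max: "\<And>X. character_graph G X \<Longrightarrow> T \<subseteq> X \<Longrightarrow> X = T"
    unfolding Z_def by (auto dest: order_trans)
  have total: "\<exists>q. (x, q) \<in> T" if xG: "x \<in> carrier G" for x
  proof -
    obtain d :: int where d: "\<And>n :: int. (\<exists>r. (x [^]\<^bsub>G\<^esub> n, r) \<in> T) \<longleftrightarrow> d dvd n"
      using character_graph_domain[OF group_axioms T(1) xG] by blast
    then obtain r where r: "(x [^]\<^bsub>G\<^esub> d, r) \<in> T" by (metis dvd_refl)
    define q where "q = (if d = 0 then 0 else r / of_int d)"
    have q: "(x [^]\<^bsub>G\<^esub> d, of_int d * q) \<in> T"
      unfolding q_def using r character_graphD(3)[OF T(1), of 0] by auto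
    obtain T' where "character_graph G T'" "T \<subseteq> T'" "(x, q) \<in> T'"
      using character_graph_adjoin[OF assms(1) T(1) xG iffD1[OF d] q] .
    then show ?thesis using max[of T'] by auto
  qed
  have unique: "frac q = frac r" if "(x, q) \<in> T" "(x, r) \<in> T" for x q r
  proof -
    have "q - r \<in> \<int>"
      using character_graphD[OF T(1)] that by (metis r_inv)
    then show ?thesis by (metis diff_add_cancel frac_add_int_left)
  qed
  define \<chi> where "\<chi> x = frac (SOME q. (x, q) \<in> T)" for x
  have \<chi>: "\<chi> x = frac q" if "(x, q) \<in> T" for x q
    unfolding \<chi>_def by (rule unique[OF someI[of "\<lambda>q. (x, q) \<in> T", OF that] that])
  have "\<chi> \<in> characters G"
    unfolding characters_def
  proof (intro CollectI conjI ballI)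
    show "\<chi> \<in> carrier G \<rightarrow> {0..<1}"
      by (auto simp: \<chi>_def frac_lt_1)
  next
    fix x y assume "x \<in> carrier G" "y \<in> carrier G"
    then obtain q r where "(x, q) \<in> T" "(y, r) \<in> T" using total by blast
    with character_graph_mult[OF group_axioms T(1) this]
    show "\<chi> (x \<otimes>\<^bsub>G\<^esub> y) = frac (\<chi> x + \<chi> y)" by (simp add: \<chi>)
  qed
  then show thesis using that \<chi> T(2) by blast
qed

text \<open>
  On the subgroup generated by \<open>x\<close> one can prescribe the value \<open>1/d\<close> at \<open>x\<close> if \<open>x\<close> has finite
  order \<open>d > 1\<close>, and any value, such as \<open>1/2\<close>, if the order is infinite. This is the case of
  adjoining \<open>x\<close> to the graph of the character of the trivial subgroup.
\<close>

lemma characters_separate: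
  assumes "comm_group G" and xG: "x \<in> carrier G" and "x \<noteq> \<one>\<^bsub>G\<^esub>"
  obtains \<chi> where "\<chi> \<in> characters G" "\<chi> x \<noteq> 0"
proof -
  interpret comm_group G by fact
  define S where "S = {\<one>\<^bsub>G\<^esub>} \<times> (\<int> :: rat set)"
  have S: "character_graph G S"
    unfolding character_graph_def S_def by auto
  obtain d :: int where d: "\<And>n :: int. (\<exists>r. (x [^]\<^bsub>G\<^esub> n, r) \<in> S) \<longleftrightarrow> d dvd n"
    using character_graph_domain[OF group_axioms S xG] by blast
  have "\<not> d dvd 1"
    using d[of 1] xG \<open>x \<noteq> \<one>\<^bsub>G\<^esub>\<close> by (simp add: S_def)
  define q :: rat where "q = (if d = 0 then 1 / 2 else 1 / of_int d)"
  have "q \<notin> \<int>"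
  proof
    assume "q \<in> \<int>"
    then obtain z where z: "q = of_int z" by (elim Ints_cases)
    have "of_int (if d = 0 then 2 else d) * q = 1" by (simp add: q_def)
    then have "of_int ((if d = 0 then 2 else d) * z) = (1 :: rat)" using z by simp
    then have "(if d = 0 then 2 else d) * z = 1" by linarith
    then show False
      using \<open>\<not> d dvd 1\<close> by (metis dvd_triv_left one_dvd odd_one)
  qed
  have "x [^]\<^bsub>G\<^esub> d = \<one>\<^bsub>G\<^esub>"
    using d[of d] by (auto simp: S_def)
  then have "(x [^]\<^bsub>G\<^esub> d, of_int d * q) \<in> S"
    by (simp add: S_def q_def)
  from character_graph_adjoin[OF assms(1) S xG _ this] d
  obtain S' where S': "character_graph G S'" "(x, q) \<in> S'" by blast
  obtain \<chi> where \<chi>: "\<chi> \<in> characters G" "\<And>y r. (y, r) \<in> S' \<Longrightarrow> \<chi> y = frac r"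
    by (rule character_graph_extends[OF assms(1) S'(1)]) (rule that, assumption, blast)
  have "\<chi> x \<noteq> 0"
    using \<chi>(2)[OF S'(2)] \<open>q \<notin> \<int>\<close> by simp
  then show thesis using that \<chi>(1) by blast
qed

text \<open>
  Injectivity of \<open>f\<close> makes the graph of \<open>\<chi> \<circ> f\<^sup>-\<^sup>1\<close> single-valued modulo \<open>\<int>\<close>; this is
  the injectivity of \<open>\<rat>/\<int>\<close> as an abelian group.
\<close>

lemma characters_extend:
  assumes "comm_group G" "comm_group H" and f: "f \<in> hom G H" "inj_on f (carrier G)"
    and \<chi>: "\<chi> \<in> characters G"
  obtains \<psi> where "\<psi> \<in> characters H" "\<And>x. x \<in> carrier G \<Longrightarrow> \<psi> (f x) = \<chi> x"
proof -
  interpret G: comm_group G by fact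
  interpret H: comm_group H by fact
  interpret group_hom G H f by (simp add: group_hom_def group_hom_axioms_def f G.is_group H.is_group)
  note \<chi>_frac = character_frac[OF \<chi>]
  define S where "S = {(f x, q) | x q. x \<in> carrier G \<and> \<chi> x = frac q}"
  have "character_graph H S"
    unfolding character_graph_def
  proof (intro conjI allI impI)
    show "S \<subseteq> carrier H \<times> UNIV" unfolding S_def by auto
  next
    fix x y q r assume "(x, q) \<in> S" "(y, r) \<in> S"
    then obtain x' y' where x': "x = f x'" "x' \<in> carrier G" "\<chi> x' = frac q"
      and y': "y = f y'" "y' \<in> carrier G" "\<chi> y' = frac r"
      unfolding S_def by blast
    have "\<chi> (x' \<otimes>\<^bsub>G\<^esub> inv\<^bsub>G\<^esub> y') = frac (q - r)"
      using character_divide[OF G.is_group \<chi> x'(2) y'(2)] x'(3) y'(3) by (simp add: frac_diff_simps)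
    moreover have "x \<otimes>\<^bsub>H\<^esub> inv\<^bsub>H\<^esub> y = f (x' \<otimes>\<^bsub>G\<^esub> inv\<^bsub>G\<^esub> y')"
      using x' y' by simp
    ultimately show "(x \<otimes>\<^bsub>H\<^esub> inv\<^bsub>H\<^esub> y, q - r) \<in> S"
      unfolding S_def using x'(2) y'(2) by blast
  next
    fix q
    have "x = \<one>\<^bsub>G\<^esub>" if "x \<in> carrier G" "f x = \<one>\<^bsub>H\<^esub>" for x
      using f(2) that by (metis G.one_closed hom_one inj_onD)
    then show "(\<one>\<^bsub>H\<^esub>, q) \<in> S \<longleftrightarrow> q \<in> \<int>"
      unfolding S_def using character_one[OF G.is_group \<chi>] frac_eq_0_iff[of q] hom_one by force
  qed
  from character_graph_extends[OF assms(2) this] obtain \<psi>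
    where \<psi>: "\<psi> \<in> characters H" "\<And>x q. (x, q) \<in> S \<Longrightarrow> \<psi> x = frac q" by blast
  have "\<psi> (f x) = \<chi> x" if "x \<in> carrier G" for x
    using \<psi>(2)[of "f x" "\<chi> x"] \<chi>_frac[OF that] that unfolding S_def by auto
  then show thesis using that \<psi>(1) by blast
qed

section \<open>Words acting on modules\<close>

lemma nijenhuis_algebraD:
  assumes "nijenhuis_algebra k A N"
  shows "assoc_algebra k A" "N \<in> linear_maps k A A"
  using assms by (auto simp: nijenhuis_algebra_def)

lemma nijenhuis_moduleD:
  assumes "nijenhuis_module k A N M"
  shows "module k M"
    and "a \<in> carrier A \<Longrightarrow> act M a \<in> linear_maps k M M"
    and "nij M \<in> linear_maps k M M"
    and "\<lbrakk>a \<in> carrier A; b \<in> carrier A; m \<in> carrier M\<rbrakk> \<Longrightarrow>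
      act M (a \<oplus>\<^bsub>A\<^esub> b) m = act M a m \<oplus>\<^bsub>M\<^esub> act M b m"
    and "\<lbrakk>c \<in> carrier k; a \<in> carrier A; m \<in> carrier M\<rbrakk> \<Longrightarrow>
      act M (c \<odot>\<^bsub>A\<^esub> a) m = c \<odot>\<^bsub>M\<^esub> act M a m"
    and "\<lbrakk>a \<in> carrier A; b \<in> carrier A; m \<in> carrier M\<rbrakk> \<Longrightarrow>
      act M (a \<otimes>\<^bsub>A\<^esub> b) m = act M a (act M b m)"
    and "m \<in> carrier M \<Longrightarrow> act M \<one>\<^bsub>A\<^esub> m = m"
    and "\<lbrakk>a \<in> carrier A; m \<in> carrier M\<rbrakk> \<Longrightarrow>
      act M (N a) (nij M m) =
      nij M (act M (N a) m \<oplus>\<^bsub>M\<^esub> act M a (nij M m) \<ominus>\<^bsub>M\<^esub> nij M (act M a m))"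
  using assms unfolding nijenhuis_module_def left_module_def by auto

lemma linear_mapsD:
  assumes "f \<in> linear_maps k M M'"
  shows "x \<in> carrier M \<Longrightarrow> f x \<in> carrier M'"
    and "\<lbrakk>x \<in> carrier M; y \<in> carrier M\<rbrakk> \<Longrightarrow> f (x \<oplus>\<^bsub>M\<^esub> y) = f x \<oplus>\<^bsub>M'\<^esub> f y"
    and "\<lbrakk>c \<in> carrier k; x \<in> carrier M\<rbrakk> \<Longrightarrow> f (c \<odot>\<^bsub>M\<^esub> x) = c \<odot>\<^bsub>M'\<^esub> f x"
  using assms unfolding linear_maps_def by auto

lemma linear_maps_hom: "f \<in> linear_maps k M M' \<Longrightarrow> f \<in> hom (add_monoid M) (add_monoid M')"
  unfolding linear_maps_def hom_def by auto

lemma nijenhuis_homsD: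
  assumes "f \<in> nijenhuis_homs k A M M'"
  shows "f \<in> linear_maps k M M'"
    and "\<lbrakk>a \<in> carrier A; m \<in> carrier M\<rbrakk> \<Longrightarrow> f (act M a m) = act M' a (f m)"
    and "m \<in> carrier M \<Longrightarrow> f (nij M m) = nij M' (f m)"
  using assms unfolding nijenhuis_homs_def by auto

lemma nijenhuis_homs_comp:
  assumes "f \<in> nijenhuis_homs k A M M'" "g \<in> nijenhuis_homs k A M' M''"
  shows "g \<circ> f \<in> nijenhuis_homs k A M M''"
  using assms unfolding nijenhuis_homs_def linear_maps_def by (auto simp: Pi_iff)

lemma characters_comp:
  assumes "f \<in> hom G H" "\<chi> \<in> characters H"
  shows "\<chi> \<circ> f \<in> characters G"
  using assms unfolding characters_def hom_def by (auto simp: Pi_iff)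

lemma module_comm_group: "module k M \<Longrightarrow> comm_group (add_monoid M)"
  by (simp add: abelian_group.a_comm_group module_def)

lemma module_character_minus:
  assumes "module k M" "\<chi> \<in> characters (add_monoid M)" "x \<in> carrier M" "y \<in> carrier M"
  shows "\<chi> (x \<ominus>\<^bsub>M\<^esub> y) = frac (\<chi> x - \<chi> y)"
  using character_divide[OF comm_group.axioms(2)[OF module_comm_group[OF assms(1)]] assms(2)]
    assms(3,4) by (simp add: a_minus_def a_inv_def)

definition letters :: "('r, 'a) module \<Rightarrow> 'a option set"
  where "letters A = insert None (Some ` carrier A)"

definition letter_act :: "('r, 'a, 'm) nij_module \<Rightarrow> 'a option \<Rightarrow> 'm \<Rightarrow> 'm"
  where "letter_act M l = (case l of None \<Rightarrow> nij M | Some a \<Rightarrow> act M a)"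

definition word_act :: "('r, 'a, 'm) nij_module \<Rightarrow> 'a option list \<Rightarrow> 'm \<Rightarrow> 'm"
  where "word_act M w = foldr (letter_act M) w"

lemma letters_simps [simp]:
  "None \<in> letters A" "Some a \<in> letters A \<longleftrightarrow> a \<in> carrier A"
  by (auto simp: letters_def)

lemma letter_act_simps [simp]:
  "letter_act M None = nij M" "letter_act M (Some a) = act M a"
  by (simp_all add: letter_act_def)

lemma word_act_simps [simp]:
  "word_act M [] m = m"
  "word_act M (l # w) m = letter_act M l (word_act M w m)"
  "word_act M (v @ w) m = word_act M v (word_act M w m)"
  by (simp_all add: word_act_def)

lemma letter_act_linear:
  assumes "nijenhuis_module k A N M" "l \<in> letters A"
  shows "letter_act M l \<in> linear_maps k M M"
  using assms nijenhuis_moduleD(2,3)[OF assms(1)] by (cases l) auto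

lemma word_act_linear:
  assumes M: "nijenhuis_module k A N M" and "w \<in> lists (letters A)"
  shows "word_act M w \<in> linear_maps k M M"
  using assms(2)
proof (induction w)
  case (Cons l w)
  then show ?case
    using linear_mapsD[OF letter_act_linear[OF M Cons.hyps(1)]] linear_mapsD[OF Cons.IH]
    unfolding linear_maps_def by auto
qed (simp add: linear_maps_def)

lemma hom_word_act:
  assumes f: "f \<in> nijenhuis_homs k A M M'" and M: "nijenhuis_module k A N M"
    and "w \<in> lists (letters A)" and m: "m \<in> carrier M"
  shows "f (word_act M w m) = word_act M' w (f m)"
  using assms(3)
proof (induction w)
  case (Cons l w)
  have "word_act M w m \<in> carrier M"
    using linear_mapsD(1)[OF word_act_linear[OF M] m] Cons.hyps by blast
  then show ?case
    using Cons nijenhuis_homsD(2,3)[OF f] by (cases l) auto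
qed simp

section \<open>Cofree modules\<close>

text \<open>
  Additive maps from the ring \<open>U\<close> of operators to \<open>\<rat>/\<int>\<close>, given by their values on words. The
  conditions say that the value only depends on the operator that a word defines on
  \<open>(A, N)\<close>-modules: the action is additive, multiplicative and unital, the operator commutes with
  scalars, and it satisfies the Nijenhuis identity. The relations stand between arbitrary words
  \<open>u\<close> and \<open>v\<close> since they generate a two-sided ideal. Lists with letters outside the algebra are
  not words and get the value \<open>0\<close>, so that a functional is determined by its values on words.
\<close>

definition word_functionals ::
    "'r ring \<Rightarrow> ('r, 'a) module \<Rightarrow> ('a \<Rightarrow> 'a) \<Rightarrow> ('a option list \<Rightarrow> rat) set"
  where "word_functionals k A N =
    {\<phi>. (\<forall>w. \<phi> w \<in> {0..<1}) \<and>
        (\<forall>w. w \<notin> lists (letters A) \<longrightarrow> \<phi> w = 0) \<and>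
        (\<forall>u v. \<forall>a\<in>carrier A. \<forall>b\<in>carrier A.
           \<phi> (u @ Some (a \<oplus>\<^bsub>A\<^esub> b) # v) = frac (\<phi> (u @ Some a # v) + \<phi> (u @ Some b # v))) \<and>
        (\<forall>u v. \<forall>a\<in>carrier A. \<forall>b\<in>carrier A.
           \<phi> (u @ Some (a \<otimes>\<^bsub>A\<^esub> b) # v) = \<phi> (u @ Some a # Some b # v)) \<and>
        (\<forall>u v. \<phi> (u @ Some \<one>\<^bsub>A\<^esub> # v) = \<phi> (u @ v)) \<and>
        (\<forall>u v. \<forall>c\<in>carrier k.
           \<phi> (u @ None # Some (c \<odot>\<^bsub>A\<^esub> \<one>\<^bsub>A\<^esub>) # v) = \<phi> (u @ Some (c \<odot>\<^bsub>A\<^esub> \<one>\<^bsub>A\<^esub>) # None # v)) \<and>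
        (\<forall>u v. \<forall>a\<in>carrier A.
           \<phi> (u @ Some (N a) # None # v) =
           frac (\<phi> (u @ None # Some (N a) # v) + \<phi> (u @ None # Some a # None # v)
                 - \<phi> (u @ None # None # Some a # v)))}"

lemma word_functionalsD:
  assumes "\<phi> \<in> word_functionals k A N"
  shows "\<phi> w \<in> {0..<1}"
    and "w \<notin> lists (letters A) \<Longrightarrow> \<phi> w = 0"
    and "\<lbrakk>a \<in> carrier A; b \<in> carrier A\<rbrakk> \<Longrightarrow>
      \<phi> (u @ Some (a \<oplus>\<^bsub>A\<^esub> b) # v) = frac (\<phi> (u @ Some a # v) + \<phi> (u @ Some b # v))"
    and "\<lbrakk>a \<in> carrier A; b \<in> carrier A\<rbrakk> \<Longrightarrow>
      \<phi> (u @ Some (a \<otimes>\<^bsub>A\<^esub> b) # v) = \<phi> (u @ Some a # Some b # v)"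
    and "\<phi> (u @ Some \<one>\<^bsub>A\<^esub> # v) = \<phi> (u @ v)"
    and "c \<in> carrier k \<Longrightarrow>
      \<phi> (u @ None # Some (c \<odot>\<^bsub>A\<^esub> \<one>\<^bsub>A\<^esub>) # v) = \<phi> (u @ Some (c \<odot>\<^bsub>A\<^esub> \<one>\<^bsub>A\<^esub>) # None # v)"
    and "a \<in> carrier A \<Longrightarrow>
      \<phi> (u @ Some (N a) # None # v) =
      frac (\<phi> (u @ None # Some (N a) # v) + \<phi> (u @ None # Some a # None # v)
            - \<phi> (u @ None # None # Some a # v))"
  using assms unfolding word_functionals_def by blast+

lemma word_functionals_zero: "(\<lambda>w. 0) \<in> word_functionals k A N"
  unfolding word_functionals_def by simp

lemma word_functionals_add:
  assumes "\<phi> \<in> word_functionals k A N" "\<psi> \<in> word_functionals k A N"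
  shows "(\<lambda>w. frac (\<phi> w + \<psi> w)) \<in> word_functionals k A N"
proof -
  note \<phi> = word_functionalsD[OF assms(1)] and \<psi> = word_functionalsD[OF assms(2)]
  have "frac (frac (x + y) + frac (x' + y')) = frac (frac (x + x') + frac (y + y'))"
    for x y x' y' :: rat
    unfolding frac_add_simps by (simp only: add_ac)
  moreover have "frac (frac (x + y - z) + frac (x' + y' - z')) =
      frac (frac (x + x') + frac (y + y') - frac (z + z'))" for x y z x' y' z' :: rat
    unfolding frac_add_diff frac_add_simps by (simp only: algebra_simps)
  ultimately show ?thesis
    unfolding word_functionals_def by (simp add: \<phi>(2-) \<psi>(2-) frac_lt_1 del: frac_add_simps)
qed

lemma word_functionals_uminus:
  assumes "\<phi> \<in> word_functionals k A N"
  shows "(\<lambda>w. frac (- \<phi> w)) \<in> word_functionals k A N"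
proof -
  note \<phi> = word_functionalsD[OF assms]
  have "frac (- frac (x + y)) = frac (frac (- x) + frac (- y))" for x y :: rat
    unfolding frac_add_simps frac_neg_frac by (simp only: minus_add add.commute)
  moreover have "frac (- frac (x + y - z)) = frac (frac (- x) + frac (- y) - frac (- z))"
    for x y z :: rat
    unfolding frac_add_diff frac_neg_frac by (simp add: algebra_simps)
  ultimately show ?thesis
    unfolding word_functionals_def by (simp add: \<phi>(2-) frac_lt_1 del: frac_add_simps)
qed

text \<open>
  Right multiplication preserves the ideal of relations: the letter is absorbed into \<open>v\<close>.
\<close>

lemma word_functionals_shift:
  assumes \<phi>: "\<phi> \<in> word_functionals k A N" and "l \<in> letters A"
  shows "(\<lambda>w. \<phi> (w @ [l])) \<in> word_functionals k A N"
  unfolding word_functionals_def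
  using word_functionalsD[OF \<phi>] by simp

definition shift :: "'l \<Rightarrow> ('j \<times> 'l list \<Rightarrow> 'q) \<Rightarrow> 'j \<times> 'l list \<Rightarrow> 'q"
  where "shift l F = (\<lambda>(j, w). F (j, w @ [l]))"

lemma shift_apply [simp]: "shift l F (j, w) = F (j, w @ [l])"
  by (simp add: shift_def)

text \<open>
  The left module structure on \<open>Hom(U, \<rat>/\<int>)\<close> comes from right multiplication on \<open>U\<close>, whence
  letters are appended at the end. A scalar \<open>c\<close> acts as the element \<open>c \<cdot> 1\<close> of the algebra.
\<close>

definition cofree_module ::
    "'r ring \<Rightarrow> ('r, 'a) module \<Rightarrow> ('a \<Rightarrow> 'a) \<Rightarrow> ('r, 'a, 'j \<times> 'a option list \<Rightarrow> rat) nij_module"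
  where "cofree_module k A N =
    \<lparr>carrier = {F. \<forall>j. (\<lambda>w. F (j, w)) \<in> word_functionals k A N},
     mult = undefined, one = undefined,
     zero = (\<lambda>_. 0), add = (\<lambda>F G p. frac (F p + G p)),
     smult = (\<lambda>c. shift (Some (c \<odot>\<^bsub>A\<^esub> \<one>\<^bsub>A\<^esub>))),
     act = (\<lambda>a. shift (Some a)), nij = shift None\<rparr>"

lemma cofree_simps [simp]:
  "\<zero>\<^bsub>cofree_module k A N\<^esub> = (\<lambda>_. 0)"
  "F \<oplus>\<^bsub>cofree_module k A N\<^esub> G = (\<lambda>p. frac (F p + G p))"
  "c \<odot>\<^bsub>cofree_module k A N\<^esub> F = shift (Some (c \<odot>\<^bsub>A\<^esub> \<one>\<^bsub>A\<^esub>)) F"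
  "act (cofree_module k A N) a F = shift (Some a) F"
  "nij (cofree_module k A N) F = shift None F"
  by (simp_all add: cofree_module_def)

lemma cofree_carrier:
  "F \<in> carrier (cofree_module k A N) \<longleftrightarrow> (\<forall>j. (\<lambda>w. F (j, w)) \<in> word_functionals k A N)"
  by (simp add: cofree_module_def)

lemma cofree_carrierD:
  assumes "F \<in> carrier (cofree_module k A N)"
  shows "frac (F p) = F p"
    and "w \<notin> lists (letters A) \<Longrightarrow> F (j, w) = 0"
    and "\<lbrakk>a \<in> carrier A; b \<in> carrier A\<rbrakk> \<Longrightarrow>
      F (j, u @ Some (a \<oplus>\<^bsub>A\<^esub> b) # v) = frac (F (j, u @ Some a # v) + F (j, u @ Some b # v))"
    and "\<lbrakk>a \<in> carrier A; b \<in> carrier A\<rbrakk> \<Longrightarrow>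
      F (j, u @ Some (a \<otimes>\<^bsub>A\<^esub> b) # v) = F (j, u @ Some a # Some b # v)"
    and "F (j, u @ Some \<one>\<^bsub>A\<^esub> # v) = F (j, u @ v)"
    and "c \<in> carrier k \<Longrightarrow>
      F (j, u @ None # Some (c \<odot>\<^bsub>A\<^esub> \<one>\<^bsub>A\<^esub>) # v) = F (j, u @ Some (c \<odot>\<^bsub>A\<^esub> \<one>\<^bsub>A\<^esub>) # None # v)"
    and "a \<in> carrier A \<Longrightarrow>
      F (j, u @ Some (N a) # None # v) =
      frac (F (j, u @ None # Some (N a) # v) + F (j, u @ None # Some a # None # v)
            - F (j, u @ None # None # Some a # v))"
proof -
  have F: "(\<lambda>w. F (j, w)) \<in> word_functionals k A N" for j
    using assms by (simp add: cofree_carrier)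
  show "frac (F p) = F p"
    using word_functionalsD(1)[OF F, of "fst p" "snd p"] by simp
qed (use word_functionalsD(2-)[OF assms[unfolded cofree_carrier, rule_format]] in simp_all)

lemma cofree_shift_closed:
  assumes F: "F \<in> carrier (cofree_module k A N)" and l: "l \<in> letters A"
  shows "shift l F \<in> carrier (cofree_module k A N)"
  unfolding cofree_carrier
proof
  fix j
  have "(\<lambda>w. F (j, w)) \<in> word_functionals k A N"
    using F by (simp add: cofree_carrier)
  from word_functionals_shift[OF this l]
  show "(\<lambda>w. shift l F (j, w)) \<in> word_functionals k A N" by simp
qed

lemma cofree_abelian_group: "abelian_group (cofree_module k A N)"
proof (rule abelian_groupI)
  fix F assume F: "F \<in> carrier (cofree_module k A N)"
  then show "\<exists>G\<in>carrier (cofree_module k A N).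
      G \<oplus>\<^bsub>cofree_module k A N\<^esub> F = \<zero>\<^bsub>cofree_module k A N\<^esub>"
    by (intro bexI[of _ "\<lambda>p. frac (- F p)"]) (auto simp: cofree_carrier word_functionals_uminus)
qed (auto simp: cofree_carrier word_functionals_add word_functionals_zero add_ac
    cofree_carrierD(1)[unfolded cofree_carrier])

lemma cofree_minus:
  assumes F: "F \<in> carrier (cofree_module k A N)" and G: "G \<in> carrier (cofree_module k A N)"
  shows "F \<ominus>\<^bsub>cofree_module k A N\<^esub> G = (\<lambda>p. frac (F p - G p))"
proof -
  have "(\<lambda>p. frac (- G p)) \<in> carrier (cofree_module k A N)"
    using G by (auto simp: cofree_carrier word_functionals_uminus)
  then have "\<ominus>\<^bsub>cofree_module k A N\<^esub> G = (\<lambda>p. frac (- G p))"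
    using abelian_group.minus_equality[OF cofree_abelian_group _ G] by simp
  then show ?thesis by (simp add: a_minus_def)
qed

text \<open>
  Scalars are central, which is why acting by \<open>c \<cdot> 1\<close> makes the action of \<open>A\<close> linear on the cofree
  module.
\<close>

lemma assoc_algebra_scalar:
  assumes "assoc_algebra k A" "c \<in> carrier k" "a \<in> carrier A"
  shows "c \<odot>\<^bsub>A\<^esub> a = (c \<odot>\<^bsub>A\<^esub> \<one>\<^bsub>A\<^esub>) \<otimes>\<^bsub>A\<^esub> a" "c \<odot>\<^bsub>A\<^esub> a = a \<otimes>\<^bsub>A\<^esub> (c \<odot>\<^bsub>A\<^esub> \<one>\<^bsub>A\<^esub>)"
proof -
  interpret A: assoc_algebra k A by fact
  interpret ring A by (rule A.ring_axioms)
  show "c \<odot>\<^bsub>A\<^esub> a = (c \<odot>\<^bsub>A\<^esub> \<one>\<^bsub>A\<^esub>) \<otimes>\<^bsub>A\<^esub> a" "c \<odot>\<^bsub>A\<^esub> a = a \<otimes>\<^bsub>A\<^esub> (c \<odot>\<^bsub>A\<^esub> \<one>\<^bsub>A\<^esub>)"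
    using assms by (simp_all add: A.smult_mult_left A.smult_mult_right)
qed

text \<open>
  The relations of \<open>word_functionals\<close> with \<open>v\<close> the empty word are the axioms on the action and on
  the operator. Those on scalars follow, because scalars act through central elements of \<open>A\<close>.
\<close>

lemma cofree_nijenhuis_module:
  assumes alg: "nijenhuis_algebra k A N"
  shows "nijenhuis_module k A N (cofree_module k A N :: ('r, 'a, 'j \<times> 'a option list \<Rightarrow> rat) nij_module)"
    (is "nijenhuis_module k A N ?I")
proof -
  interpret A: assoc_algebra k A by (rule nijenhuis_algebraD(1)[OF alg])
  interpret ring A by (rule A.ring_axioms)
  note N = linear_mapsD(1)[OF nijenhuis_algebraD(2)[OF alg]]
  note scalar = assoc_algebra_scalar[OF nijenhuis_algebraD(1)[OF alg]]
  have one [simp]: "c \<odot>\<^bsub>A\<^esub> \<one>\<^bsub>A\<^esub> \<in> carrier A" if "c \<in> carrier k" for c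
    using that by simp
  have k: "module k ?I"
  proof (rule moduleI)
    show "cring k" by (rule A.R.is_cring)
    show "abelian_group ?I" by (rule cofree_abelian_group)
  next
    fix c F assume "c \<in> carrier k" "F \<in> carrier ?I"
    then show "c \<odot>\<^bsub>?I\<^esub> F \<in> carrier ?I" by (simp add: cofree_shift_closed)
  next
    fix c d F assume "c \<in> carrier k" "d \<in> carrier k" "F \<in> carrier ?I"
    then show "(c \<oplus>\<^bsub>k\<^esub> d) \<odot>\<^bsub>?I\<^esub> F = c \<odot>\<^bsub>?I\<^esub> F \<oplus>\<^bsub>?I\<^esub> d \<odot>\<^bsub>?I\<^esub> F"
      by (auto simp: fun_eq_iff A.smult_l_distr cofree_carrierD)
  next
    fix c F G assume "c \<in> carrier k" "F \<in> carrier ?I" "G \<in> carrier ?I"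
    then show "c \<odot>\<^bsub>?I\<^esub> (F \<oplus>\<^bsub>?I\<^esub> G) = c \<odot>\<^bsub>?I\<^esub> F \<oplus>\<^bsub>?I\<^esub> c \<odot>\<^bsub>?I\<^esub> G"
      by (auto simp: fun_eq_iff)
  next
    fix c d F assume cd: "c \<in> carrier k" "d \<in> carrier k" and F: "F \<in> carrier ?I"
    have "(c \<otimes>\<^bsub>k\<^esub> d) \<odot>\<^bsub>A\<^esub> \<one>\<^bsub>A\<^esub> = (c \<odot>\<^bsub>A\<^esub> \<one>\<^bsub>A\<^esub>) \<otimes>\<^bsub>A\<^esub> (d \<odot>\<^bsub>A\<^esub> \<one>\<^bsub>A\<^esub>)"
      using cd by (simp add: A.smult_assoc1 scalar(1)[symmetric])
    then show "(c \<otimes>\<^bsub>k\<^esub> d) \<odot>\<^bsub>?I\<^esub> F = c \<odot>\<^bsub>?I\<^esub> (d \<odot>\<^bsub>?I\<^esub> F)"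
      using cd F by (auto simp: fun_eq_iff cofree_carrierD(4)[OF F])
  next
    fix F assume F: "F \<in> carrier ?I"
    then show "\<one>\<^bsub>k\<^esub> \<odot>\<^bsub>?I\<^esub> F = F"
      by (auto simp: fun_eq_iff A.smult_one cofree_carrierD(5)[OF F])
  qed
  have comm: "F (j, w @ [Some a, Some (c \<odot>\<^bsub>A\<^esub> \<one>\<^bsub>A\<^esub>)]) = F (j, w @ [Some (c \<odot>\<^bsub>A\<^esub> a)])"
      "F (j, w @ [Some (c \<odot>\<^bsub>A\<^esub> \<one>\<^bsub>A\<^esub>), Some a]) = F (j, w @ [Some (c \<odot>\<^bsub>A\<^esub> a)])"
    if "F \<in> carrier ?I" "c \<in> carrier k" "a \<in> carrier A" for F j w a c
    using that(2,3) cofree_carrierD(4)[OF that(1), of a "c \<odot>\<^bsub>A\<^esub> \<one>\<^bsub>A\<^esub>" j w "[]"]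
      cofree_carrierD(4)[OF that(1), of "c \<odot>\<^bsub>A\<^esub> \<one>\<^bsub>A\<^esub>" a j w "[]"]
    by (simp_all flip: scalar)
  have act: "act ?I a \<in> linear_maps k ?I ?I" if "a \<in> carrier A" for a
    unfolding linear_maps_def using that
    by (auto simp: fun_eq_iff cofree_shift_closed comm)
  have act_add: "act ?I (a \<oplus>\<^bsub>A\<^esub> b) F = act ?I a F \<oplus>\<^bsub>?I\<^esub> act ?I b F"
    if "a \<in> carrier A" "b \<in> carrier A" "F \<in> carrier ?I" for a b F
    using that by (auto simp: fun_eq_iff cofree_carrierD(3))
  have act_smult: "act ?I (c \<odot>\<^bsub>A\<^esub> a) F = c \<odot>\<^bsub>?I\<^esub> act ?I a F"
    if "c \<in> carrier k" "a \<in> carrier A" "F \<in> carrier ?I" for c a F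
    using that by (auto simp: fun_eq_iff comm)
  have act_mult: "act ?I (a \<otimes>\<^bsub>A\<^esub> b) F = act ?I a (act ?I b F)"
    if "a \<in> carrier A" "b \<in> carrier A" "F \<in> carrier ?I" for a b F
    using that by (auto simp: fun_eq_iff cofree_carrierD(4))
  have act_one: "act ?I \<one>\<^bsub>A\<^esub> F = F" if "F \<in> carrier ?I" for F
    using that by (auto simp: fun_eq_iff cofree_carrierD(5))
  have nij: "nij ?I \<in> linear_maps k ?I ?I"
    unfolding linear_maps_def by (auto simp: fun_eq_iff cofree_shift_closed cofree_carrierD(6))
  have Nij: "act ?I (N a) (nij ?I F) =
      nij ?I (act ?I (N a) F \<oplus>\<^bsub>?I\<^esub> act ?I a (nij ?I F) \<ominus>\<^bsub>?I\<^esub> nij ?I (act ?I a F))"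
    if a: "a \<in> carrier A" and F: "F \<in> carrier ?I" for a F
  proof -
    have "act ?I (N a) F \<oplus>\<^bsub>?I\<^esub> act ?I a (nij ?I F) \<in> carrier ?I"
      by (rule abelian_groupE(1)[OF cofree_abelian_group linear_mapsD(1)[OF act[OF N[OF a]] F]
            linear_mapsD(1)[OF act[OF a] linear_mapsD(1)[OF nij F]]])
    moreover have "nij ?I (act ?I a F) \<in> carrier ?I"
      using linear_mapsD(1)[OF act] linear_mapsD(1)[OF nij] a F by blast
    ultimately have minus: "act ?I (N a) F \<oplus>\<^bsub>?I\<^esub> act ?I a (nij ?I F) \<ominus>\<^bsub>?I\<^esub> nij ?I (act ?I a F) =
        (\<lambda>p. frac ((act ?I (N a) F \<oplus>\<^bsub>?I\<^esub> act ?I a (nij ?I F)) p - nij ?I (act ?I a F) p))"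
      by (rule cofree_minus)
    show ?thesis
      unfolding minus using cofree_carrierD(7)[OF F a, of _ _ "[]"]
      by (simp add: fun_eq_iff frac_diff_simps)
  qed
  show ?thesis
    unfolding nijenhuis_module_def left_module_def
    by (intro conjI ballI k act nij Nij act_add act_smult act_mult act_one) assumption+
qed

text \<open>
  Evaluation of \<open>w F\<close> at the empty word is evaluation of \<open>F\<close> at \<open>w\<close>; hence homomorphisms into the
  cofree module are determined by their values at empty words.
\<close>

lemma word_act_cofree: "word_act (cofree_module k A N) w F (j, v) = F (j, v @ w)"
proof (induction w arbitrary: v)
  case (Cons l w)
  then show ?case by (cases l) auto
qed simp

text \<open>
  The homomorphism that corresponds, under the adjunction between the cofree and the forgetful
  functor, to a family of characters.
\<close>

definition orbit_map ::
    "('r, 'a) module \<Rightarrow> ('r, 'a, 'm) nij_module \<Rightarrow> ('j \<Rightarrow> 'm \<Rightarrow> rat) \<Rightarrow> 'm \<Rightarrow> 'j \<times> 'a option list \<Rightarrow> rat"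
  where "orbit_map A M \<psi> m =
    (\<lambda>(j, w). if w \<in> lists (letters A) then \<psi> j (word_act M w m) else 0)"

lemma orbit_map_apply:
  "orbit_map A M \<psi> m (j, w) = (if w \<in> lists (letters A) then \<psi> j (word_act M w m) else 0)"
  by (simp add: orbit_map_def)

text \<open>
  After moving \<open>v\<close> into the point and \<open>u\<close> into the character \<open>\<theta> u = \<psi> j \<circ> u\<close>, every relation becomes
  an axiom of \<open>M\<close> at the point \<open>v m\<close>, to which an additive map is applied.
\<close>

lemma orbit_map_closed:
  assumes alg: "nijenhuis_algebra k A N" and M: "nijenhuis_module k A N M"
    and \<psi>: "\<And>j. \<psi> j \<in> characters (add_monoid M)" and m: "m \<in> carrier M"
  shows "orbit_map A M \<psi> m \<in> carrier (cofree_module k A N)"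
  unfolding cofree_carrier
proof
  fix j
  interpret A: assoc_algebra k A by (rule nijenhuis_algebraD(1)[OF alg])
  interpret ring A by (rule A.ring_axioms)
  interpret M: module k M by (rule nijenhuis_moduleD(1)[OF M])
  note N = linear_mapsD(1)[OF nijenhuis_algebraD(2)[OF alg]]
  have word: "word_act M w m \<in> carrier M" if "w \<in> lists (letters A)" for w
    using linear_mapsD(1)[OF word_act_linear[OF M that] m] .
  define \<theta> where "\<theta> u = (\<lambda>y. \<psi> j (word_act M u y))" for u
  have \<theta>: "\<theta> u \<in> characters (add_monoid M)" if "u \<in> lists (letters A)" for u
    using characters_comp[OF linear_maps_hom[OF word_act_linear[OF M that]] \<psi>[of j]]
    by (simp add: \<theta>_def comp_def)
  have \<theta>_add: "\<theta> u (x \<oplus>\<^bsub>M\<^esub> y) = frac (\<theta> u x + \<theta> u y)"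
    if "u \<in> lists (letters A)" "x \<in> carrier M" "y \<in> carrier M" for u x y
    using character_mult[OF \<theta>[OF that(1)]] that by simp
  have \<theta>_minus: "\<theta> u (x \<ominus>\<^bsub>M\<^esub> y) = frac (\<theta> u x - \<theta> u y)"
    if "u \<in> lists (letters A)" "x \<in> carrier M" "y \<in> carrier M" for u x y
    using module_character_minus[OF M.module_axioms \<theta>] that by simp
  have act: "act M a y \<in> carrier M" if "a \<in> carrier A" "y \<in> carrier M" for a y
    using linear_mapsD(1)[OF nijenhuis_moduleD(2)[OF M]] that by blast
  have nij: "nij M y \<in> carrier M" if "y \<in> carrier M" for y
    using linear_mapsD(1)[OF nijenhuis_moduleD(3)[OF M]] that by blast
  have Nij: "\<theta> u (act M (N a) (nij M y)) =
      frac (\<theta> (u @ [None]) (act M (N a) y) + \<theta> (u @ [None]) (act M a (nij M y))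
            - \<theta> (u @ [None]) (nij M (act M a y)))"
    if "u \<in> lists (letters A)" "a \<in> carrier A" "y \<in> carrier M" for u a y
  proof -
    have "\<theta> u (act M (N a) (nij M y)) = \<theta> (u @ [None])
        (act M (N a) y \<oplus>\<^bsub>M\<^esub> act M a (nij M y) \<ominus>\<^bsub>M\<^esub> nij M (act M a y))"
      using nijenhuis_moduleD(8)[OF M] that by (simp add: \<theta>_def)
    also have "\<dots> = frac (\<theta> (u @ [None]) (act M (N a) y) + \<theta> (u @ [None]) (act M a (nij M y))
            - \<theta> (u @ [None]) (nij M (act M a y)))"
      using that N by (simp add: \<theta>_minus \<theta>_add act nij frac_diff_simps)
    finally show ?thesis .
  qed
  have scalar: "act M (c \<odot>\<^bsub>A\<^esub> \<one>\<^bsub>A\<^esub>) y = c \<odot>\<^bsub>M\<^esub> y" if "c \<in> carrier k" "y \<in> carrier M" for c y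
    using nijenhuis_moduleD(5,7)[OF M] that by simp
  have orbit: "orbit_map A M \<psi> m (j, u @ v) =
      (if u \<in> lists (letters A) \<and> v \<in> lists (letters A) then \<theta> u (word_act M v m) else 0)" for u v
    by (simp add: orbit_map_apply \<theta>_def)
  show "(\<lambda>w. orbit_map A M \<psi> m (j, w)) \<in> word_functionals k A N"
    unfolding word_functionals_def
  proof (intro CollectI conjI allI ballI impI)
    fix w show "orbit_map A M \<psi> m (j, w) \<in> {0..<1}"
      using character_range[OF \<psi>[of j]] word by (auto simp: orbit_map_apply)
  next
    fix w assume "w \<notin> lists (letters A)"
    then show "orbit_map A M \<psi> m (j, w) = 0" by (simp add: orbit_map_apply)
  next
    fix u v a b assume "a \<in> carrier A" "b \<in> carrier A"
    then show "orbit_map A M \<psi> m (j, u @ Some (a \<oplus>\<^bsub>A\<^esub> b) # v) =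
        frac (orbit_map A M \<psi> m (j, u @ Some a # v) + orbit_map A M \<psi> m (j, u @ Some b # v))"
      using word[of v] by (simp add: orbit \<theta>_add act nijenhuis_moduleD(4)[OF M])
  next
    fix u v a b assume "a \<in> carrier A" "b \<in> carrier A"
    then show "orbit_map A M \<psi> m (j, u @ Some (a \<otimes>\<^bsub>A\<^esub> b) # v) =
        orbit_map A M \<psi> m (j, u @ Some a # Some b # v)"
      using word[of v] by (simp add: orbit nijenhuis_moduleD(6)[OF M])
  next
    fix u v show "orbit_map A M \<psi> m (j, u @ Some \<one>\<^bsub>A\<^esub> # v) = orbit_map A M \<psi> m (j, u @ v)"
      using word[of v] by (simp add: orbit nijenhuis_moduleD(7)[OF M])
  next
    fix u v c assume "c \<in> carrier k"
    then show "orbit_map A M \<psi> m (j, u @ None # Some (c \<odot>\<^bsub>A\<^esub> \<one>\<^bsub>A\<^esub>) # v) =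
        orbit_map A M \<psi> m (j, u @ Some (c \<odot>\<^bsub>A\<^esub> \<one>\<^bsub>A\<^esub>) # None # v)"
      using word[of v] by (simp add: orbit scalar nij linear_mapsD(3)[OF nijenhuis_moduleD(3)[OF M]])
  next
    fix u v a assume "a \<in> carrier A"
    then show "orbit_map A M \<psi> m (j, u @ Some (N a) # None # v) =
        frac (orbit_map A M \<psi> m (j, u @ None # Some (N a) # v)
              + orbit_map A M \<psi> m (j, u @ None # Some a # None # v)
              - orbit_map A M \<psi> m (j, u @ None # None # Some a # v))"
      using word[of v] N Nij[of u a "word_act M v m"] by (simp add: orbit \<theta>_def)
  qed
qed

lemma orbit_map_hom:
  assumes alg: "nijenhuis_algebra k A N" and M: "nijenhuis_module k A N M"
    and \<psi>: "\<And>j. \<psi> j \<in> characters (add_monoid M)"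
  shows "orbit_map A M \<psi> \<in> nijenhuis_homs k A M (cofree_module k A N)"
proof -
  interpret A: assoc_algebra k A by (rule nijenhuis_algebraD(1)[OF alg])
  interpret ring A by (rule A.ring_axioms)
  note word = word_act_linear[OF M]
  have add: "orbit_map A M \<psi> (x \<oplus>\<^bsub>M\<^esub> y) (j, w) =
      frac (orbit_map A M \<psi> x (j, w) + orbit_map A M \<psi> y (j, w))"
    if "x \<in> carrier M" "y \<in> carrier M" for x y j w
    using character_mult[OF \<psi>[of j]] linear_mapsD(1,2)[OF word] that
    by (simp add: orbit_map_apply)
  have scalar: "act M (c \<odot>\<^bsub>A\<^esub> \<one>\<^bsub>A\<^esub>) y = c \<odot>\<^bsub>M\<^esub> y" if "c \<in> carrier k" "y \<in> carrier M" for c y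
    using nijenhuis_moduleD(5,7)[OF M] that by simp
  have letter: "orbit_map A M \<psi> (letter_act M l m) = shift l (orbit_map A M \<psi> m)"
    if "l \<in> letters A" for l m
  proof
    fix p show "orbit_map A M \<psi> (letter_act M l m) p = shift l (orbit_map A M \<psi> m) p"
      using that by (cases p) (simp add: orbit_map_apply)
  qed
  have smult: "orbit_map A M \<psi> (c \<odot>\<^bsub>M\<^esub> m) = shift (Some (c \<odot>\<^bsub>A\<^esub> \<one>\<^bsub>A\<^esub>)) (orbit_map A M \<psi> m)"
    if "c \<in> carrier k" "m \<in> carrier M" for c m
    using letter[of "Some (c \<odot>\<^bsub>A\<^esub> \<one>\<^bsub>A\<^esub>)" m] scalar[OF that] that by simp
  show ?thesis
    unfolding nijenhuis_homs_def linear_maps_def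
    using orbit_map_closed[OF alg M, of \<psi>, OF \<psi>] add smult letter[of "Some _"] letter[of None]
    by (auto simp: fun_eq_iff)
qed

section \<open>Injectivity and embeddings\<close>

text \<open>
  The characters \<open>m \<mapsto> g m (j, [])\<close> extend along \<open>f\<close> to \<open>M'\<close>, and the homomorphism built from the
  extensions restricts to \<open>g\<close> because both have the same values at empty words.
\<close>

lemma cofree_extension:
  fixes g :: "'m \<Rightarrow> 'j \<times> 'a option list \<Rightarrow> rat"
  assumes alg: "nijenhuis_algebra k A N"
    and M: "nijenhuis_module k A N M" and M': "nijenhuis_module k A N M'"
    and f: "f \<in> nijenhuis_homs k A M M'" "inj_on f (carrier M)"
    and g: "g \<in> nijenhuis_homs k A M (cofree_module k A N)"
  shows "\<exists>h \<in> nijenhuis_homs k A M' (cofree_module k A N). \<forall>m\<in>carrier M. h (f m) = g m"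
proof -
  note gI = linear_mapsD[OF nijenhuis_homsD(1)[OF g]]
  have "(\<lambda>m. g m (j, [])) \<in> characters (add_monoid M)" for j
    using gI(2) cofree_carrierD(1)[OF gI(1)] by (auto simp: characters_def frac_eq)
  then have "\<exists>\<psi>. \<psi> \<in> characters (add_monoid M') \<and> (\<forall>m\<in>carrier M. \<psi> (f m) = g m (j, []))" for j
    using characters_extend[OF module_comm_group[OF nijenhuis_moduleD(1)[OF M]]
        module_comm_group[OF nijenhuis_moduleD(1)[OF M']] linear_maps_hom[OF nijenhuis_homsD(1)[OF f(1)]]]
      f(2) by (metis partial_object.select_convs(1))
  then obtain \<psi> where \<psi>: "\<And>j. \<psi> j \<in> characters (add_monoid M')"
    and \<psi>f: "\<And>j m. m \<in> carrier M \<Longrightarrow> \<psi> j (f m) = g m (j, [])"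
    by metis
  have "orbit_map A M' \<psi> (f m) (j, w) = g m (j, w)" if m: "m \<in> carrier M" for m j w
  proof (cases "w \<in> lists (letters A)")
    case True
    have "\<psi> j (word_act M' w (f m)) = \<psi> j (f (word_act M w m))"
      using hom_word_act[OF f(1) M True m] by simp
    also have "\<dots> = g (word_act M w m) (j, [])"
      using \<psi>f linear_mapsD(1)[OF word_act_linear[OF M True] m] by simp
    also have "\<dots> = g m (j, w)"
      using hom_word_act[OF g M True m] by (simp add: word_act_cofree)
    finally show ?thesis using True by (simp add: orbit_map_apply)
  next
    case False
    then show ?thesis
      using cofree_carrierD(2)[OF gI(1)[OF m] False] by (simp add: orbit_map_apply)
  qed
  then show ?thesis
    using orbit_map_hom[OF alg M' \<psi>] by (intro bexI[of _ "orbit_map A M' \<psi>"]) (auto simp: fun_eq_iff)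
qed

lemma cofree_injective_against:
  assumes "nijenhuis_algebra k A N"
  shows "injective_against S T k A N (cofree_module k A N)"
  unfolding injective_against_def
  using cofree_nijenhuis_module[OF assms] cofree_extension[OF assms] by blast

text \<open>
  The index type consists of all functions \<open>'m \<Rightarrow> rat\<close>. Those that are not characters of \<open>M\<close> are
  replaced by the zero character, which adds trivial components only.
\<close>

lemma embedding_into_cofree:
  fixes M :: "('r, 'a, 'm) nij_module"
  assumes alg: "nijenhuis_algebra k A N" and M: "nijenhuis_module k A N M"
  obtains e :: "'m \<Rightarrow> ('a, 'm) char_space"
  where "e \<in> nijenhuis_homs k A M (cofree_module k A N)" "inj_on e (carrier M)"
proof -
  interpret module k M by (rule nijenhuis_moduleD(1)[OF M])
  define \<psi> where "\<psi> \<chi> = (if \<chi> \<in> characters (add_monoid M) then \<chi> else (\<lambda>_. 0))" for \<chi>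
  have "\<psi> \<chi> \<in> characters (add_monoid M)" for \<chi>
    by (simp add: \<psi>_def) (simp add: characters_def)
  then have hom: "orbit_map A M \<psi> \<in> nijenhuis_homs k A M (cofree_module k A N)"
    by (rule orbit_map_hom[OF alg M])
  have "inj_on (orbit_map A M \<psi>) (carrier M)"
  proof (rule inj_onI, rule ccontr)
    fix x y assume x: "x \<in> carrier M" and y: "y \<in> carrier M"
      and eq: "orbit_map A M \<psi> x = orbit_map A M \<psi> y" and "x \<noteq> y"
    then have "x \<ominus>\<^bsub>M\<^esub> y \<noteq> \<zero>\<^bsub>M\<^esub>"
      using minus_equality[of x "\<ominus>\<^bsub>M\<^esub> y"] by (auto simp: a_minus_def)
    then obtain \<chi> where \<chi>: "\<chi> \<in> characters (add_monoid M)" "\<chi> (x \<ominus>\<^bsub>M\<^esub> y) \<noteq> 0"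
      using characters_separate[OF module_comm_group[OF module_axioms], of "x \<ominus>\<^bsub>M\<^esub> y"] x y by auto
    have "\<chi> x = \<chi> y"
      using fun_cong[OF eq, of "(\<chi>, [])"] \<chi>(1) by (simp add: orbit_map_apply \<psi>_def)
    then show False
      using \<chi>(2) module_character_minus[OF module_axioms \<chi>(1) x y] by simp
  qed
  then show thesis using that hom by blast
qed

text \<open>
  The extension property of \<open>I\<close> is used once, on the embedding \<open>e\<close> of \<open>I\<close> into a cofree module, to
  obtain a retraction \<open>r\<close> of \<open>e\<close>. A homomorphism \<open>g\<close> into \<open>I\<close> then extends to \<open>r \<circ> h\<close>, where \<open>h\<close>
  extends \<open>e \<circ> g\<close>.
\<close>

lemma injective_module_against:
  fixes I :: "('r, 'a, 'i) nij_module"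
  assumes alg: "nijenhuis_algebra k A N" and inj: "injective_module k A N I"
  shows "injective_against S T k A N I"
proof -
  let ?E = "cofree_module k A N :: ('r, 'a, ('a, 'i) char_space) nij_module"
  have I: "nijenhuis_module k A N I"
    using inj by (simp add: injective_module_def injective_against_def)
  obtain e where e: "e \<in> nijenhuis_homs k A I ?E" "inj_on e (carrier I)"
    using embedding_into_cofree[OF alg I] by blast
  have "(\<lambda>x. x) \<in> nijenhuis_homs k A I I"
    by (simp add: nijenhuis_homs_def linear_maps_def)
  then obtain r where r: "r \<in> nijenhuis_homs k A ?E I" "\<And>x. x \<in> carrier I \<Longrightarrow> r (e x) = x"
    using inj[unfolded injective_module_def injective_against_def] I e
      cofree_nijenhuis_module[OF alg] by (metis (no_types, lifting))
  show ?thesis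
    unfolding injective_against_def
  proof (intro conjI allI impI I)
    fix M M' f g
    assume M: "nijenhuis_module k A N M" "nijenhuis_module k A N M'"
      and f: "f \<in> nijenhuis_homs k A M M'" "inj_on f (carrier M)"
      and g: "g \<in> nijenhuis_homs k A M I"
    obtain h where h: "h \<in> nijenhuis_homs k A M' ?E" "\<And>m. m \<in> carrier M \<Longrightarrow> h (f m) = e (g m)"
      using cofree_extension[OF alg M f nijenhuis_homs_comp[OF g e(1)]] by auto
    have "(r \<circ> h) (f m) = g m" if "m \<in> carrier M" for m
      using that h(2) r(2) linear_mapsD(1)[OF nijenhuis_homsD(1)[OF g]] by simp
    then show "\<exists>h\<in>nijenhuis_homs k A M' I. \<forall>m\<in>carrier M. h (f m) = g m"
      using nijenhuis_homs_comp[OF h(1) r(1)] by blast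
  qed
qed

(* The second conjunct, in which 's and 't are arbitrary types, says that injective_module is
   injectivity against modules over all types; in particular one and the same I works for all of
   them. *)
theorem theorem4p8:
  fixes k :: "'r ring" and A :: "('r, 'a) module" and N :: "'a \<Rightarrow> 'a"
    and M :: "('r, 'a, 'm) nij_module"
  assumes "nijenhuis_algebra k A N"
    and "nijenhuis_module k A N M"
  shows "(\<exists>(I :: ('r, 'a, ('a, 'm) char_space) nij_module) f.
            injective_module k A N I \<and>
            f \<in> nijenhuis_homs k A M I \<and> inj_on f (carrier M)) \<and>
         (\<forall>I :: ('r, 'a, 'i) nij_module.
            injective_module k A N I \<longrightarrow> injective_against TYPE('s) TYPE('t) k A N I)"
proof
  obtain e :: "'m \<Rightarrow> ('a, 'm) char_space"
    where "e \<in> nijenhuis_homs k A M (cofree_module k A N)" "inj_on e (carrier M)"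
    using embedding_into_cofree[OF assms] by blast
  moreover have "injective_module k A N
      (cofree_module k A N :: ('r, 'a, ('a, 'm) char_space) nij_module)"
    unfolding injective_module_def by (rule cofree_injective_against[OF assms(1)])
  ultimately show "\<exists>(I :: ('r, 'a, ('a, 'm) char_space) nij_module) f.
            injective_module k A N I \<and>
            f \<in> nijenhuis_homs k A M I \<and> inj_on f (carrier M)"
    by blast
qed (use injective_module_against[OF assms(1)] in blast)

end
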